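(* Let $T\in\mathscr L(M,V')$, $f\in V'$ with $f\ne0$, and let $\mu\in E$ be a solution of $T\mu=f$ which satisfies $\varepsilon^{\mathrm{int}}_h(\mu)\leq1/2$. Fix $r>0$ such that $\|\mu\|_E\leq r\|\mu\|_M$. Let $\mu_h\in M_h$ be a solution of $$\mu_h=\operatorname*{arg\,min}_{m\in M_h}\|T_hm-f_h\|_{V_h'}.$$ If $\alpha(T_h)>0$, then $$\frac{\|\mu_h-\pi_h\mu\|_M}{\|\pi_h\mu\|_M}\leq\frac{4}{\alpha(T_h)}\left[r\,\varepsilon^{\mathrm{op}}_h+\rho(T)\left(\varepsilon^{\mathrm{rhs}}_h+\varepsilon^{\mathrm{int}}_h(\mu)\right)\right].$$ Moreover, if there exists $\alpha^*>0$ such that $\alpha(T_h)\geq\alpha^*$ for all $h>0$, and if $\varepsilon^{\mathrm{op}}_h\to0$ and $\varepsilon^{\mathrm{rhs}}_h\to0$ as $h\to0$, then $\|\mu_h-\mu\|_M\to0$ as $h\to0$.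
   Context: Setting. $M$ and $V$ are real Hilbert spaces; $E\subset M$ is a Banach space (with its own norm $\|\cdot\|_E$) that is dense in $M$; $V'$ is the dual of $V$ (bounded linear forms) with the operator norm; $\mathscr L(M,V')$ is the space of bounded linear operators. Discretization. $(M_h)_{h>0}$ and $(V_h)_{h>0}$ are families of finite-dimensional subspaces of $M$ and $V$ that approach $M$ and $V$ respectively: a family $(X_h)_{h>0}$ of subspaces of $X$ approaches $X$ if for every $x\in X$ there are $x_h\in X_h$ with $\|x_h-x\|_X\to0$ as $h\to0$. $M_h$, $V_h$ carry the norms of $M$, $V$. One has $M_h\subset E$, and $E_h$ denotes $M_h$ endowed with the $E$-norm. $\pi_h:M\to M_h$ is the orthogonal projection, and it is assumed that $\|\pi_h m\|_E\le\|m\|_E$ for all $m\in E$. For nonzero $\mu\in M$, $\varepsilon^{\mathrm{int}}_h(\mu):=\|\pi_h\mu-\mu\|_M/\|\mu\|_M$. $V_h'$ is the space of linear forms on $V_h$ with norm $\|g\|_{V_h'}=\sup_{v\in V_h}\langle g,v\rangle/\|v\|_V$; elements of $V'$ are regarded as elements of $V_h'$ by restriction. For each $h>0$, an operator $T_h\in\mathscr L(M_h,V_h')$ and an element $f_h\in V_h'$ are given, and $$\varepsilon^{\mathrm{op}}_h:=\sup_{\mu\in E_h}\sup_{v\in V_h}\frac{\langle (T_h-T)\mu,v\rangle_{V_h',V_h}}{\|\mu\|_E\|v\|_V},\qquad \varepsilon^{\mathrm{rhs}}_h:=\frac1{\|f\|_{V'}}\sup_{v\in V_h}\frac{\langle f_h-f,v\rangle_{V_h',V_h}}{\|v\|_V}.$$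 Constants. All infima and suprema of quotients are over nonzero vectors. For $T\in\mathscr L(M,V')$, $$\rho(T):=\sup_{\mu\in M}\sup_{v\in V}\frac{\langle T\mu,v\rangle_{V',V}}{\|\mu\|_M\|v\|_V},$$ and $$\alpha(T_h):=\inf_{\mu\in M_h}\sup_{v\in V_h}\frac{\langle T_h\mu,v\rangle_{V_h',V_h}}{\|\mu\|_M\|v\|_V}.$$ *)

theory Defs
  imports "HOL-Analysis.Analysis"
begin

text \<open>
  The Hilbert spaces \<open>M\<close> and \<open>V\<close> are types of class \<open>{real_inner, complete_space}\<close>, and the dual
  \<open>V'\<close> is the type \<open>'v \<Rightarrow>\<^sub>L real\<close>.  The Banach space \<open>E\<close> is a subset of \<open>M\<close> together with a norm
  \<open>nE\<close>, which is only meaningful on \<open>E\<close>.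
\<close>

definition norm_on :: "'a::real_vector set \<Rightarrow> ('a \<Rightarrow> real) \<Rightarrow> bool" where
  "norm_on E nE \<longleftrightarrow>
     (\<forall>x\<in>E. 0 \<le> nE x) \<and>
     (\<forall>x\<in>E. nE x = 0 \<longleftrightarrow> x = 0) \<and>
     (\<forall>x\<in>E. \<forall>y\<in>E. nE (x + y) \<le> nE x + nE y) \<and>
     (\<forall>c. \<forall>x\<in>E. nE (c *\<^sub>R x) = \<bar>c\<bar> * nE x)"

definition banach_on :: "'a::real_vector set \<Rightarrow> ('a \<Rightarrow> real) \<Rightarrow> bool" where
  "banach_on E nE \<longleftrightarrow> subspace E \<and> norm_on E nE \<and>
     (\<forall>X :: nat \<Rightarrow> 'a.
        (\<forall>n. X n \<in> E) \<and> (\<forall>e>0. \<exists>N. \<forall>m\<ge>N. \<forall>n\<ge>N. nE (X m - X n) < e) \<longrightarrow>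
        (\<exists>x\<in>E. (\<lambda>n. nE (X n - x)) \<longlonglongrightarrow> 0))"

definition fin_dim_subspace :: "'a::real_vector set \<Rightarrow> bool" where
  "fin_dim_subspace S \<longleftrightarrow> (\<exists>B. finite B \<and> S = span B)"

definition approaches :: "(real \<Rightarrow> 'a::real_normed_vector set) \<Rightarrow> bool" where
  "approaches X \<longleftrightarrow>
     (\<forall>x. \<exists>xh. (\<forall>h>0. xh h \<in> X h) \<and> ((\<lambda>h. norm (xh h - x)) \<longlongrightarrow> 0) (at_right 0))"

text \<open>On a finite-dimensional subspace the point below exists and is unique.\<close>

definition orth_proj :: "'a::real_inner set \<Rightarrow> 'a \<Rightarrow> 'a" where
  "orth_proj S x = (THE p. p \<in> S \<and> (\<forall>s\<in>S. orthogonal (x - p) s))"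

text \<open>
  Linear forms on a subspace \<open>S\<close> of \<open>V\<close> are represented by functions on all of \<open>V\<close> whose values
  outside \<open>S\<close> are irrelevant; restriction of an element of \<open>V'\<close> is then just application.
  Similarly, an operator \<open>M\<^sub>h \<rightarrow> V\<^sub>h'\<close> is a function \<open>A\<close> such that \<open>A m v\<close> is the value of the form
  \<open>A m\<close> at \<open>v\<close>.
\<close>

definition linear_form_on :: "'a::real_vector set \<Rightarrow> ('a \<Rightarrow> real) \<Rightarrow> bool" where
  "linear_form_on S g \<longleftrightarrow>
     (\<forall>x\<in>S. \<forall>y\<in>S. g (x + y) = g x + g y) \<and>
     (\<forall>c. \<forall>x\<in>S. g (c *\<^sub>R x) = c * g x)"

text \<open>
  All suprema and infima of quotients are taken in \<^typ>\<open>ereal\<close>, so that they exist without side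
  conditions.  Over the nonzero vectors of a trivial space a supremum is \<open>-\<infinity>\<close> and an infimum is \<open>\<infinity>\<close>.
  Hence the dual norm below is \<open>-\<infinity>\<close> instead of the usual \<open>0\<close> when \<open>V\<^sub>h = {0}\<close>.  This is harmless: the
  dual norm is only minimized over forms on a fixed \<open>V\<^sub>h\<close> or bounded from above, and if
  \<open>M\<^sub>h \<noteq> {0}\<close> and \<open>V\<^sub>h = {0}\<close>, then \<open>alpha\<close> is \<open>-\<infinity>\<close>, hence not positive.
\<close>

definition dual_norm_on :: "'v::real_normed_vector set \<Rightarrow> ('v \<Rightarrow> real) \<Rightarrow> ereal" where
  "dual_norm_on S g = (SUP v\<in>S - {0}. ereal (g v / norm v))"

definition bounded_operator_on ::
  "'m::real_normed_vector set \<Rightarrow> 'v::real_normed_vector set \<Rightarrow> ('m \<Rightarrow> 'v \<Rightarrow> real) \<Rightarrow> bool" where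
  "bounded_operator_on Mh Vh A \<longleftrightarrow>
     (\<forall>m\<in>Mh. linear_form_on Vh (A m)) \<and>
     (\<forall>v\<in>Vh. linear_form_on Mh (\<lambda>m. A m v)) \<and>
     (\<exists>C. \<forall>m\<in>Mh. dual_norm_on Vh (A m) \<le> ereal (C * norm m))"

definition rho ::
  "('m::real_normed_vector \<Rightarrow>\<^sub>L ('v::real_normed_vector \<Rightarrow>\<^sub>L real)) \<Rightarrow> ereal" where
  "rho T = (SUP \<mu>\<in>UNIV - {0}. SUP v\<in>UNIV - {0}. ereal (T \<mu> v / (norm \<mu> * norm v)))"

definition alpha ::
  "'m::real_normed_vector set \<Rightarrow> 'v::real_normed_vector set \<Rightarrow> ('m \<Rightarrow> 'v \<Rightarrow> real) \<Rightarrow> ereal" where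
  "alpha Mh Vh A = (INF \<mu>\<in>Mh - {0}. SUP v\<in>Vh - {0}. ereal (A \<mu> v / (norm \<mu> * norm v)))"

definition eps_int :: "'m::real_inner set \<Rightarrow> 'm \<Rightarrow> real" where
  "eps_int Mh \<mu> = norm (orth_proj Mh \<mu> - \<mu>) / norm \<mu>"

definition eps_op ::
  "('m::real_normed_vector \<Rightarrow> real) \<Rightarrow> 'm set \<Rightarrow> 'v::real_normed_vector set \<Rightarrow>
   ('m \<Rightarrow> 'v \<Rightarrow> real) \<Rightarrow> ('m \<Rightarrow>\<^sub>L ('v \<Rightarrow>\<^sub>L real)) \<Rightarrow> ereal" where
  "eps_op nE Mh Vh A T =
     (SUP \<mu>\<in>Mh - {0}. SUP v\<in>Vh - {0}. ereal ((A \<mu> v - T \<mu> v) / (nE \<mu> * norm v)))"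

definition eps_rhs ::
  "'v::real_normed_vector set \<Rightarrow> ('v \<Rightarrow> real) \<Rightarrow> ('v \<Rightarrow>\<^sub>L real) \<Rightarrow> ereal" where
  "eps_rhs Vh g f = ereal (1 / norm f) * (SUP v\<in>Vh - {0}. ereal ((g v - f v) / norm v))"

end

theory Submission
  imports Defs
begin

text \<open>
  Write \<open>p = \<pi>\<^sub>h \<mu>\<close>.  Since \<open>p\<close> competes in the minimisation defining \<open>\<mu>\<^sub>h\<close>, the triangle inequality
  gives \<open>\<alpha>(T\<^sub>h) \<parallel>\<mu>\<^sub>h - p\<parallel> \<le> \<parallel>T\<^sub>h (\<mu>\<^sub>h - p)\<parallel> \<le> 2 \<parallel>T\<^sub>h p - f\<^sub>h\<parallel>\<close>.  The residual splits as
  \<open>T\<^sub>h p - f\<^sub>h = (T\<^sub>h - T) p + T (p - \<mu>) + (f - f\<^sub>h)\<close>, whose terms are controlled by the operator,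
  interpolation and right-hand side errors, using \<open>\<parallel>p\<parallel>\<^sub>E \<le> \<parallel>\<mu>\<parallel>\<^sub>E \<le> r \<parallel>\<mu>\<parallel>\<close> and
  \<open>\<parallel>f\<parallel> \<le> \<rho>(T) \<parallel>\<mu>\<parallel>\<close>.  The condition on \<open>\<epsilon>\<^sup>i\<^sup>n\<^sup>t\<close> gives \<open>\<parallel>\<mu>\<parallel> \<le> 2 \<parallel>p\<parallel>\<close>, which produces the factor \<open>4\<close>.
\<close>

section \<open>Orthogonal projection onto finite-dimensional subspaces\<close>

lemma fin_dim_subspace_imp_subspace: "fin_dim_subspace S \<Longrightarrow> subspace S"
  by (auto simp: fin_dim_subspace_def subspace_span)

text \<open>Gram-Schmidt yields an orthogonal spanning set \<open>C\<close>, and the Fourier sum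
  over \<open>C\<close> is the projection; orthogonality to \<open>C\<close> extends to its span by
  linearity.\<close>

lemma orthogonal_decomposition_span:
  fixes x :: "'a::real_inner"
  assumes "finite B"
  shows "\<exists>p\<in>span B. \<forall>s\<in>span B. orthogonal (x - p) s"
proof -
  obtain C where C: "finite C" "span C = span B" "pairwise orthogonal C"
    using basis_orthogonal[OF assms] by blast
  let ?p = "\<Sum>b\<in>C. (b \<bullet> x / (b \<bullet> b)) *\<^sub>R b"
  have "?p \<in> span C"
    by (intro span_sum span_scale span_base)
  moreover have "orthogonal (x - ?p) c" if "c \<in> C" for c
  proof -
    \<comment> \<open>\<open>C\<close> may contain 0: the coefficient is then 0 by division by zero,
      in agreement with \<open>0 \<bullet> x = 0\<close>.\<close>
    have "?p \<bullet> c = (\<Sum>b\<in>C. if b = c then c \<bullet> x else 0)"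
      unfolding inner_sum_left using C(3) that
      by (intro sum.cong) (auto simp: pairwise_def orthogonal_def)
    also have "\<dots> = c \<bullet> x"
      using C(1) that by simp
    finally show ?thesis
      by (simp add: orthogonal_def inner_diff_left inner_commute[of x c])
  qed
  then have "orthogonal (x - ?p) s" if "s \<in> span C" for s
    using that orthogonal_to_span by blast
  ultimately show ?thesis
    using C(2) by auto
qed

text \<open>These two facts justify the description operator in \<open>orth_proj\<close>. Existence
  is the preceding lemma; for uniqueness, the difference of two candidates lies in \<open>S\<close>
  and is orthogonal to itself.\<close>

lemma
  fixes x :: "'a::real_inner"
  assumes "fin_dim_subspace S"
  shows orth_proj_in: "orth_proj S x \<in> S"
    and orth_proj_orthogonal: "s \<in> S \<Longrightarrow> orthogonal (x - orth_proj S x) s"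
proof -
  have sub: "subspace S"
    using assms by (rule fin_dim_subspace_imp_subspace)
  obtain p where p: "p \<in> S" "\<forall>s\<in>S. orthogonal (x - p) s"
    using assms orthogonal_decomposition_span by (metis fin_dim_subspace_def)
  have uniq: "q = p" if q: "q \<in> S" "\<forall>s\<in>S. orthogonal (x - q) s" for q
  proof -
    have "q - p \<in> S"
      using q p sub by (simp add: subspace_diff)
    then have "(x - p) \<bullet> (q - p) = 0" "(x - q) \<bullet> (q - p) = 0"
      using q p by (auto simp: orthogonal_def)
    then have "(q - p) \<bullet> (q - p) = 0"
      by (simp add: inner_diff_left)
    then show "q = p" by simp
  qed
  have "orth_proj S x = p"
    unfolding orth_proj_def
  proof (rule the_equality)
    show "p \<in> S \<and> (\<forall>s\<in>S. orthogonal (x - p) s)"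
      using p by blast
  qed (rule uniq; blast)
  then show "orth_proj S x \<in> S" "s \<in> S \<Longrightarrow> orthogonal (x - orth_proj S x) s"
    using p by simp_all
qed

text \<open>Pythagoras applied to \<open>s - x = (s - p) + (p - x)\<close>, where \<open>p\<close>
  is the projection and the first summand lies in \<open>S\<close>.\<close>

lemma orth_proj_minimal:
  fixes x :: "'a::real_inner"
  assumes "fin_dim_subspace S" "s \<in> S"
  shows "norm (orth_proj S x - x) \<le> norm (s - x)"
proof -
  let ?p = "orth_proj S x"
  have "s - ?p \<in> S"
    using assms by (simp add: orth_proj_in subspace_diff fin_dim_subspace_imp_subspace)
  then have "orthogonal (s - ?p) (?p - x)"
    using orth_proj_orthogonal[OF assms(1), of "s - ?p" x]
    by (simp add: orthogonal_def inner_diff_left inner_diff_right inner_commute)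
  from norm_add_Pythagorean[OF this]
  have "(norm (?p - x))\<^sup>2 \<le> (norm (s - x))\<^sup>2"
    by simp
  then show ?thesis
    by (rule power2_le_imp_le) simp
qed

section \<open>Dual norm bounds and linear forms on a subspace\<close>

lemma dual_norm_on_le_iff:
  "dual_norm_on S g \<le> ereal K \<longleftrightarrow> (\<forall>v\<in>S - {0}. g v \<le> K * norm v)"
  unfolding dual_norm_on_def SUP_le_iff by (auto simp: divide_simps)

lemma linear_form_on_apply_diff:
  assumes "linear_form_on S g" "subspace S" "x \<in> S" "y \<in> S"
  shows "g (x - y) = g x - g y"
proof -
  have "g ((x - y) + y) = g (x - y) + g y"
    using assms unfolding linear_form_on_def by (meson subspace_diff)
  then show ?thesis by simp
qed

lemma linear_form_on_apply_minus:
  assumes "linear_form_on S g" "x \<in> S"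
  shows "g (- x) = - g x"
proof -
  have "g ((- 1) *\<^sub>R x) = (- 1) * g x"
    using assms unfolding linear_form_on_def by blast
  then show ?thesis by simp
qed

lemma linear_form_on_blinfun_apply: "linear_form_on S (blinfun_apply f)"
  by (simp add: linear_form_on_def blinfun.add_right blinfun.scaleR_right)

lemma linear_form_on_diff:
  assumes "linear_form_on S g" "linear_form_on S k"
  shows "linear_form_on S (\<lambda>v. g v - k v)"
  using assms by (simp add: linear_form_on_def algebra_simps)

section \<open>From extended-real suprema and infima to real inequalities\<close>

lemma rho_le_imp_bound:
  fixes T :: "'m::real_normed_vector \<Rightarrow>\<^sub>L ('v::real_normed_vector \<Rightarrow>\<^sub>L real)"
  assumes "rho T \<le> ereal R"
  shows "T m v \<le> R * norm m * norm v"
proof (cases "m = 0 \<or> v = 0")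
  case False
  then have "ereal (T m v / (norm m * norm v)) \<le> rho T"
    unfolding rho_def by (intro SUP_upper2[of m] SUP_upper2[of v]) auto
  then have "T m v / (norm m * norm v) \<le> R"
    using assms by (metis ereal_less_eq(3) order_trans)
  then show ?thesis
    using False by (simp add: divide_simps mult.assoc)
qed auto

lemma rho_le_norm:
  fixes T :: "'m::real_normed_vector \<Rightarrow>\<^sub>L ('v::real_normed_vector \<Rightarrow>\<^sub>L real)"
  shows "rho T \<le> ereal (norm T)"
  unfolding rho_def SUP_le_iff
proof (intro ballI)
  fix m :: 'm and v :: 'v assume "m \<in> UNIV - {0}" "v \<in> UNIV - {0}"
  moreover have "norm (T m v) \<le> norm T * norm m * norm v"
    by (rule order_trans[OF norm_blinfun mult_right_mono[OF norm_blinfun norm_ge_zero]])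
  then have "T m v \<le> norm T * norm m * norm v"
    by simp
  ultimately show "ereal (T m v / (norm m * norm v)) \<le> ereal (norm T)"
    by (simp add: divide_simps mult.assoc)
qed

text \<open>A nonpositive \<open>rho T\<close> would give \<open>T m v \<le> 0\<close> for
  \<open>v\<close> and \<open>- v\<close> alike, hence \<open>T m = 0\<close>. Strict positivity
  matters because 0 times infinity is 0 in \<open>ereal\<close>.\<close>

lemma rho_pos:
  fixes T :: "'m::real_normed_vector \<Rightarrow>\<^sub>L ('v::real_normed_vector \<Rightarrow>\<^sub>L real)"
  assumes "T m \<noteq> 0"
  shows "rho T > 0"
proof (rule ccontr)
  assume "\<not> rho T > 0"
  then have "rho T \<le> ereal 0" by (simp add: zero_ereal_def)
  from rho_le_imp_bound[OF this] have "T m v \<le> 0" for v by simp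
  from this this[of "- v" for v] have "T m v = 0" for v
    by (simp add: blinfun.minus_right order_antisym)
  then show False
    using assms by (auto intro: blinfun_eqI)
qed

text \<open>Here \<open>nE\<close> is an arbitrary function, so positivity at \<open>m\<close> is
  assumed in order to clear the denominator.\<close>

lemma eps_op_le_imp_bound:
  fixes T :: "'m::real_normed_vector \<Rightarrow>\<^sub>L ('v::real_normed_vector \<Rightarrow>\<^sub>L real)"
  assumes "eps_op nE S U A T \<le> ereal e" "m \<in> S - {0}" "v \<in> U - {0}" "nE m > 0"
  shows "A m v - T m v \<le> e * nE m * norm v"
proof -
  have "ereal ((A m v - T m v) / (nE m * norm v)) \<le> eps_op nE S U A T"
    unfolding eps_op_def by (intro SUP_upper2[of m] SUP_upper2[of v]) (use assms in auto)
  then have "(A m v - T m v) / (nE m * norm v) \<le> e"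
    using assms(1) by (metis ereal_less_eq(3) order_trans)
  then show ?thesis
    using assms by (simp add: divide_simps mult.assoc)
qed

lemma eps_rhs_le_imp_bound:
  fixes f :: "'v::real_normed_vector \<Rightarrow>\<^sub>L real"
  assumes "eps_rhs U g f \<le> ereal s" "v \<in> U - {0}" "f \<noteq> 0"
  shows "g v - f v \<le> s * norm f * norm v"
proof -
  have "ereal ((g v - f v) / norm v) \<le> (SUP v\<in>U - {0}. ereal ((g v - f v) / norm v))"
    using assms by (intro SUP_upper) auto
  then have "ereal (1 / norm f) * ereal ((g v - f v) / norm v) \<le> eps_rhs U g f"
    unfolding eps_rhs_def by (intro ereal_mult_left_mono) auto
  then have "ereal ((1 / norm f) * ((g v - f v) / norm v)) \<le> ereal s"
    using assms(1) by (simp only: times_ereal.simps)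
  then show ?thesis
    using assms by (simp add: divide_simps mult_ac)
qed

text \<open>Adding the bounds at \<open>v\<close> and \<open>- v\<close> cancels the form. This is
  how the one-sided suprema in the error quantities are seen to be nonnegative.\<close>

lemma nonneg_if_bounds_linear_form:
  assumes "linear_form_on S g" "subspace S" "v \<in> S - {0}"
    and bound: "\<And>w. w \<in> S - {0} \<Longrightarrow> g w \<le> K * norm w"
  shows "K \<ge> 0"
proof -
  have "- v \<in> S - {0}"
    using assms by (simp add: subspace_neg)
  then have "- g v \<le> K * norm v" "g v \<le> K * norm v"
    using bound[of "- v"] bound[of v] assms linear_form_on_apply_minus[OF assms(1), of v] by auto
  then have "0 \<le> K * norm v" by linarith
  then show ?thesis
    using assms(3) by (simp add: zero_le_mult_iff)
qed

text \<open>A nonzero \<open>v\<close> excludes the empty supremum, whose value is minus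
  infinity.\<close>

lemma eps_rhs_nonneg:
  fixes f :: "'v::real_normed_vector \<Rightarrow>\<^sub>L real"
  assumes "linear_form_on U g" "subspace U" "v \<in> U - {0}" "f \<noteq> 0"
  shows "eps_rhs U g f \<ge> 0"
\<comment> \<open>It suffices that every real upper bound is nonnegative; this also covers the value
  infinity, which has no real upper bound.\<close>
proof (rule ereal_le_real)
  fix s assume "eps_rhs U g f \<le> ereal s"
  then have "s * norm f \<ge> 0"
    using nonneg_if_bounds_linear_form[OF linear_form_on_diff[OF assms(1) linear_form_on_blinfun_apply, of f] assms(2,3)]
      eps_rhs_le_imp_bound assms(4) by blast
  then show "0 \<le> ereal s"
    using assms(4) by (simp add: zero_le_mult_iff)
qed

lemma eps_op_nonneg:
  fixes T :: "'m::real_normed_vector \<Rightarrow>\<^sub>L ('v::real_normed_vector \<Rightarrow>\<^sub>L real)"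
  assumes "linear_form_on U (A m)" "subspace U" "v \<in> U - {0}" "m \<in> S - {0}" "nE m > 0"
  shows "eps_op nE S U A T \<ge> 0"
proof (rule ereal_le_real)
  fix e assume "eps_op nE S U A T \<le> ereal e"
  then have "e * nE m \<ge> 0"
    using nonneg_if_bounds_linear_form[OF linear_form_on_diff[OF assms(1) linear_form_on_blinfun_apply, of "T m"] assms(2,3)]
      eps_op_le_imp_bound assms(4,5) by blast
  then show "0 \<le> ereal e"
    using assms(5) by (simp add: zero_le_mult_iff)
qed

text \<open>The inf-sup condition as a stability estimate: a bound on the form \<open>A d\<close>
  controls \<open>d\<close> itself. The sign of \<open>K\<close> settles \<open>d = 0\<close>, which
  the infimum leaves out.\<close>

lemma alpha_le_imp_bound:
  assumes "ereal a \<le> alpha S U A" "d \<in> S"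
    and bound: "\<And>v. v \<in> U - {0} \<Longrightarrow> A d v \<le> K * norm v" and "K \<ge> 0"
  shows "a * norm d \<le> K"
proof (cases "d = 0")
  case False
  have "alpha S U A \<le> (SUP v\<in>U - {0}. ereal (A d v / (norm d * norm v)))"
    unfolding alpha_def using assms False by (intro INF_lower) auto
  also have "\<dots> \<le> ereal (K / norm d)"
    unfolding SUP_le_iff using bound False by (auto simp: divide_simps mult_ac)
  finally have "a \<le> K / norm d"
    using assms(1) by (metis ereal_less_eq(3) order_trans)
  then show ?thesis
    using False by (simp add: divide_simps)
qed (use assms in auto)

text \<open>A single nonzero \<open>m\<close> bounds the infimum by the continuity constant of
  \<open>A\<close>. Thus a positive \<open>alpha\<close> is a real number and can be divided by as
  usual.\<close>

lemma alpha_less_top: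
  assumes "bounded_operator_on S U A" "m \<in> S - {0}"
  shows "alpha S U A < \<infinity>"
proof -
  obtain C where "\<forall>m\<in>S. dual_norm_on U (A m) \<le> ereal (C * norm m)"
    using assms unfolding bounded_operator_on_def by blast
  then have C: "A m v \<le> C * norm m * norm v" if "v \<in> U - {0}" for v
    using assms(2) that by (auto simp: dual_norm_on_le_iff)
  have "alpha S U A \<le> (SUP v\<in>U - {0}. ereal (A m v / (norm m * norm v)))"
    unfolding alpha_def using assms by (intro INF_lower) auto
  also have "\<dots> \<le> ereal C"
    unfolding SUP_le_iff using C assms by (auto simp: divide_simps mult_ac)
  finally show ?thesis by auto
qed

text \<open>If \<open>U\<close> were trivial, the inner supremum at \<open>m\<close> would be minus
  infinity. The vector obtained feeds the nonnegativity lemmas for the errors.\<close>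

lemma alpha_pos_imp_nontrivial:
  assumes "alpha S U A > 0" "m \<in> S - {0}"
  obtains v where "v \<in> U - {0}"
proof (cases "U - {0} = {}")
  case True
  have "alpha S U A \<le> (SUP v\<in>U - {0}. ereal (A m v / (norm m * norm v)))"
    unfolding alpha_def using assms by (intro INF_lower) auto
  then show ?thesis
    using assms(1) by (simp only: True) (simp add: bot_ereal_def)
qed (use that in blast)

section \<open>Stability, consistency and the relative error\<close>

lemma arg_min_stability:
  assumes S: "subspace S" and U: "subspace U"
    and A: "bounded_operator_on S U A" and g: "linear_form_on U g"
    and q: "is_arg_min (\<lambda>m. dual_norm_on U (\<lambda>v. A m v - g v)) (\<lambda>m. m \<in> S) q"
    and p: "p \<in> S" and K: "dual_norm_on U (\<lambda>v. A p v - g v) \<le> ereal K" "K \<ge> 0"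
    and a: "ereal a \<le> alpha S U A"
  shows "a * norm (q - p) \<le> 2 * K"
proof (rule alpha_le_imp_bound[OF a])
  have qS: "q \<in> S" and "dual_norm_on U (\<lambda>v. A q v - g v) \<le> dual_norm_on U (\<lambda>v. A p v - g v)"
    using q p by (auto simp: is_arg_min_def not_less)
  then have Kq: "dual_norm_on U (\<lambda>v. A q v - g v) \<le> ereal K"
    using K order_trans by blast
  show "q - p \<in> S"
    using qS p S by (simp add: subspace_diff)
  fix v assume v: "v \<in> U - {0}"
  then have v': "- v \<in> U - {0}"
    using U by (simp add: subspace_neg)
  have "A q v - g v \<le> K * norm v"
    using Kq v by (simp add: dual_norm_on_le_iff)
  \<comment> \<open>The residual of \<open>p\<close> enters \<open>A (q - p)\<close> with a minus
    sign. As the dual norm bounds forms only from above, the test vector is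
    \<open>- v\<close>.\<close>
  moreover have "A p (- v) - g (- v) \<le> K * norm (- v)"
    using K v' unfolding dual_norm_on_le_iff by blast
  moreover have "A p (- v) = - A p v" "g (- v) = - g v"
    using A g p v by (auto simp: bounded_operator_on_def intro!: linear_form_on_apply_minus)
  moreover have "A (q - p) v = A q v - A p v"
    using A p qS v S linear_form_on_apply_diff[of S "\<lambda>m. A m v"] by (auto simp: bounded_operator_on_def)
  ultimately show "A (q - p) v \<le> 2 * K * norm v" by simp
qed (use K in simp)

lemma consistency_bound:
  fixes T :: "'m::real_normed_vector \<Rightarrow>\<^sub>L ('v::real_normed_vector \<Rightarrow>\<^sub>L real)"
  assumes U: "subspace U" and g: "linear_form_on U g"
    and p: "p \<in> S - {0}" "nE p > 0" "nE p \<le> r * norm \<mu>"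
    and f: "f \<noteq> 0" "T \<mu> = f"
    and e: "eps_op nE S U A T \<le> ereal e" "e \<ge> 0"
    and s: "eps_rhs U g f \<le> ereal s" "s \<ge> 0"
    and R: "rho T \<le> ereal R" "R \<ge> 0"
  shows "dual_norm_on U (\<lambda>v. A p v - g v)
    \<le> ereal (norm \<mu> * (r * e + R * s) + R * norm (p - \<mu>))"
  unfolding dual_norm_on_le_iff
proof
  fix v assume v: "v \<in> U - {0}"
  then have v': "- v \<in> U - {0}"
    using U by (simp add: subspace_neg)
  have "A p v - T p v \<le> e * nE p * norm v"
    using eps_op_le_imp_bound[OF e(1) p(1) v p(2)] .
  also have "\<dots> \<le> e * (r * norm \<mu>) * norm v"
    using p e by (intro mult_right_mono mult_left_mono) auto
  finally have op: "A p v - T p v \<le> e * (r * norm \<mu>) * norm v" .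
  have T: "T (p - \<mu>) v \<le> R * norm (p - \<mu>) * norm v"
    by (rule rho_le_imp_bound[OF R(1)])
  \<comment> \<open>The right-hand side error is relative to \<open>norm f\<close>; this bound makes
    it relative to \<open>norm \<mu>\<close>, at the price of the factor \<open>R\<close>.\<close>
  have "norm f \<le> R * norm \<mu>"
  proof (rule norm_blinfun_bound)
    fix w
    have "f w \<le> R * norm \<mu> * norm w" "f (- w) \<le> R * norm \<mu> * norm (- w)"
      using rho_le_imp_bound[OF R(1), of \<mu>] f(2) by blast+
    then show "norm (f w) \<le> R * norm \<mu> * norm w"
      by (simp add: blinfun.minus_right abs_le_iff)
  qed (use R in simp)
  then have "s * norm f * norm v \<le> s * (R * norm \<mu>) * norm v"
    using s by (intro mult_right_mono mult_left_mono) auto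
  \<comment> \<open>The error bound concerns \<open>g - f\<close>, so it is used at
    \<open>- v\<close>.\<close>
  moreover have "f v - g v \<le> s * norm f * norm v"
    using eps_rhs_le_imp_bound[OF s(1) v' f(1)] linear_form_on_apply_minus[OF g, of v] v
    by (simp add: blinfun.minus_right)
  moreover have "A p v - g v = (A p v - T p v) + T (p - \<mu>) v + (f v - g v)"
    using f(2) by (simp add: blinfun.diff_left blinfun.diff_right)
  ultimately have "A p v - g v
      \<le> e * (r * norm \<mu>) * norm v + R * norm (p - \<mu>) * norm v + s * (R * norm \<mu>) * norm v"
    using op T by linarith
  then show "A p v - g v \<le> (norm \<mu> * (r * e + R * s) + R * norm (p - \<mu>)) * norm v"
    by (simp add: algebra_simps)
qed

text \<open>The interpolation error is at most half of \<open>norm \<mu>\<close>, so the reverse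
  triangle inequality leaves at least the other half to the projection.\<close>

lemma
  assumes "eps_int S \<mu> \<le> 1 / 2" "\<mu> \<noteq> 0"
  shows norm_le_twice_orth_proj: "norm \<mu> \<le> 2 * norm (orth_proj S \<mu>)"
    and orth_proj_nonzero: "orth_proj S \<mu> \<noteq> 0"
proof -
  have "norm (orth_proj S \<mu> - \<mu>) \<le> norm \<mu> / 2"
    using assms by (simp add: eps_int_def divide_simps)
  then show *: "norm \<mu> \<le> 2 * norm (orth_proj S \<mu>)"
    using norm_triangle_ineq2[of \<mu> "orth_proj S \<mu>"] by (simp add: norm_minus_commute)
  show "orth_proj S \<mu> \<noteq> 0"
    using * assms(2) by auto
qed

text \<open>Real bounds \<open>e\<close>, \<open>s\<close>, \<open>R\<close> and \<open>a\<close>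
  stand in for the extended-real quantities. The lemma thus serves both with their exact values, for
  the estimate, and with thresholds, for convergence.\<close>

lemma relative_error_bound:
  fixes T :: "'m::real_inner \<Rightarrow>\<^sub>L ('v::real_normed_vector \<Rightarrow>\<^sub>L real)"
  assumes S: "fin_dim_subspace S" and U: "subspace U"
    and A: "bounded_operator_on S U A" and g: "linear_form_on U g"
    and q: "is_arg_min (\<lambda>m. dual_norm_on U (\<lambda>v. A m v - g v)) (\<lambda>m. m \<in> S) q"
    and f: "f \<noteq> 0" "T \<mu> = f"
    and int: "eps_int S \<mu> \<le> 1 / 2"
    and nE: "nE (orth_proj S \<mu>) > 0" "nE (orth_proj S \<mu>) \<le> r * norm \<mu>"
    and e: "eps_op nE S U A T \<le> ereal e" "e \<ge> 0"
    and s: "eps_rhs U g f \<le> ereal s" "s \<ge> 0"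
    and R: "rho T \<le> ereal R" "R \<ge> 0"
    and a: "ereal a \<le> alpha S U A" "a > 0" and r: "r \<ge> 0"
  shows "norm (q - orth_proj S \<mu>) / norm (orth_proj S \<mu>)
    \<le> 4 / a * (r * e + R * (s + eps_int S \<mu>))"
proof -
  let ?p = "orth_proj S \<mu>" and ?B = "r * e + R * (s + eps_int S \<mu>)"
  have \<mu>: "\<mu> \<noteq> 0"
    using f by auto
  have p: "?p \<in> S" "?p \<noteq> 0" "norm \<mu> \<le> 2 * norm ?p"
    using orth_proj_in[OF S] orth_proj_nonzero[OF int \<mu>] norm_le_twice_orth_proj[OF int \<mu>] by auto
  have B: "?B \<ge> 0"
    using e s R r by (simp add: eps_int_def)
  \<comment> \<open>By definition \<open>norm (?p - \<mu>)\<close> is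
    \<open>eps_int S \<mu> * norm \<mu>\<close>, so \<open>norm \<mu>\<close> factors out.\<close>
  have K: "norm \<mu> * (r * e + R * s) + R * norm (?p - \<mu>) = norm \<mu> * ?B"
    using \<mu> by (simp add: eps_int_def algebra_simps)
  have "dual_norm_on U (\<lambda>v. A ?p v - g v) \<le> ereal (norm \<mu> * ?B)"
    using consistency_bound[OF U g _ nE f e s R] p unfolding K by simp
  then have "a * norm (q - ?p) \<le> 2 * (norm \<mu> * ?B)"
    using B by (intro arg_min_stability[OF fin_dim_subspace_imp_subspace[OF S] U A g q p(1) _ _ a(1)]) auto
  also have "\<dots> \<le> 2 * (2 * norm ?p * ?B)"
    using B p by (intro mult_left_mono mult_right_mono) auto
  finally have "a * norm (q - ?p) \<le> 4 * ?B * norm ?p"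
    by (simp add: algebra_simps)
  then show ?thesis
    using p a by (simp add: divide_le_eq pos_le_divide_eq mult.commute)
qed

text \<open>By minimality the projection is at least as close to \<open>x\<close> as the
  approximants supplied by \<open>approaches\<close>.\<close>

lemma eps_int_tendsto_0:
  assumes fin: "\<And>h. h > 0 \<Longrightarrow> fin_dim_subspace (X h)" and "approaches X"
  shows "((\<lambda>h. eps_int (X h) x) \<longlongrightarrow> 0) (at_right 0)"
proof -
  obtain xh where xh: "\<And>h. h > 0 \<Longrightarrow> xh h \<in> X h" "((\<lambda>h. norm (xh h - x)) \<longlongrightarrow> 0) (at_right 0)"
    using assms(2) unfolding approaches_def by blast
  have "((\<lambda>h. norm (orth_proj (X h) x - x)) \<longlongrightarrow> 0) (at_right 0)"
  proof (rule tendsto_sandwich[OF _ _ tendsto_const xh(2)])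
    show "\<forall>\<^sub>F h in at_right 0. norm (orth_proj (X h) x - x) \<le> norm (xh h - x)"
      using eventually_at_right_less[of "0::real"]
      by eventually_elim (simp add: orth_proj_minimal fin xh)
  qed simp
  then show ?thesis
    unfolding eps_int_def by (rule tendsto_divide_zero)
qed

section \<open>The estimate in extended reals and convergence of the discrete solutions\<close>

theorem theorem3:
  fixes E :: "'m::{real_inner, complete_space} set"
    and nE :: "'m \<Rightarrow> real"
    and Mh :: "real \<Rightarrow> 'm set"
    and Vh :: "real \<Rightarrow> 'v::{real_inner, complete_space} set"
    and Th :: "real \<Rightarrow> 'm \<Rightarrow> 'v \<Rightarrow> real"
    and fh :: "real \<Rightarrow> 'v \<Rightarrow> real"
    and T :: "'m \<Rightarrow>\<^sub>L ('v \<Rightarrow>\<^sub>L real)"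
    and f :: "'v \<Rightarrow>\<^sub>L real"
    and \<mu> :: 'm
    and r :: real
    and \<mu>h :: "real \<Rightarrow> 'm"
  assumes E_banach: "banach_on E nE"
    and E_dense: "closure E = UNIV"
    and Mh_fin: "\<And>h. h > 0 \<Longrightarrow> fin_dim_subspace (Mh h)"
    and Vh_fin: "\<And>h. h > 0 \<Longrightarrow> fin_dim_subspace (Vh h)"
    and Mh_approaches: "approaches Mh"
    and Vh_approaches: "approaches Vh"
    and Mh_E: "\<And>h. h > 0 \<Longrightarrow> Mh h \<subseteq> E"
    and proj_E: "\<And>h m. h > 0 \<Longrightarrow> m \<in> E \<Longrightarrow> nE (orth_proj (Mh h) m) \<le> nE m"
    and Th_op: "\<And>h. h > 0 \<Longrightarrow> bounded_operator_on (Mh h) (Vh h) (Th h)"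
    and fh_form: "\<And>h. h > 0 \<Longrightarrow> linear_form_on (Vh h) (fh h)"
    and f_nz: "f \<noteq> 0"
    and mu_E: "\<mu> \<in> E"
    and mu_sol: "T \<mu> = f"
    and r_pos: "r > 0"
    and r_bound: "nE \<mu> \<le> r * norm \<mu>"
    and muh_min: "\<And>h. h > 0 \<Longrightarrow>
      is_arg_min (\<lambda>m. dual_norm_on (Vh h) (\<lambda>v. Th h m v - fh h v)) (\<lambda>m. m \<in> Mh h) (\<mu>h h)"
  shows "(\<forall>h>0. eps_int (Mh h) \<mu> \<le> 1 / 2 \<and> alpha (Mh h) (Vh h) (Th h) > 0 \<longrightarrow>
            ereal (norm (\<mu>h h - orth_proj (Mh h) \<mu>) / norm (orth_proj (Mh h) \<mu>))
            \<le> 4 / alpha (Mh h) (Vh h) (Th h) *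
                (ereal r * eps_op nE (Mh h) (Vh h) (Th h) T
                 + rho T * (eps_rhs (Vh h) (fh h) f + ereal (eps_int (Mh h) \<mu>))))
       \<and> ((\<exists>\<alpha>::real. \<alpha> > 0 \<and> (\<forall>h>0. alpha (Mh h) (Vh h) (Th h) \<ge> ereal \<alpha>)) \<and>
          ((\<lambda>h. eps_op nE (Mh h) (Vh h) (Th h) T) \<longlongrightarrow> 0) (at_right 0) \<and>
          ((\<lambda>h. eps_rhs (Vh h) (fh h) f) \<longlongrightarrow> 0) (at_right 0)
          \<longrightarrow> ((\<lambda>h. norm (\<mu>h h - \<mu>)) \<longlongrightarrow> 0) (at_right 0))"
proof (intro conjI impI allI)
  have \<mu>: "\<mu> \<noteq> 0"
    using mu_sol f_nz by auto
  define R where "R = real_of_ereal (rho T)"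
  have "rho T > 0"
    using rho_pos[of T \<mu>] mu_sol f_nz by simp
  then have R: "rho T = ereal R" "R > 0"
    using rho_le_norm[of T] unfolding R_def by (cases "rho T"; simp)+
  note V = fin_dim_subspace_imp_subspace[OF Vh_fin]
  have nE: "nE (orth_proj (Mh h) \<mu>) > 0" "nE (orth_proj (Mh h) \<mu>) \<le> r * norm \<mu>"
    if "h > 0" "eps_int (Mh h) \<mu> \<le> 1 / 2" for h
  proof -
    have "orth_proj (Mh h) \<mu> \<in> E" "orth_proj (Mh h) \<mu> \<noteq> 0"
      using orth_proj_in[OF Mh_fin] orth_proj_nonzero \<mu> Mh_E that by blast+
    then show "nE (orth_proj (Mh h) \<mu>) > 0"
      using E_banach unfolding banach_on_def norm_on_def by (metis less_le)
    show "nE (orth_proj (Mh h) \<mu>) \<le> r * norm \<mu>"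
      using proj_E[OF that(1) mu_E] r_bound by linarith
  qed
  \<comment> \<open>The numerical bounds stay free: exact values are inserted in the first claim, a
    threshold \<delta> in the second.\<close>
  note bound = relative_error_bound[where nE = nE and A = "Th h" and g = "fh h" for h,
      OF Mh_fin V Th_op fh_form muh_min f_nz mu_sol]

  show "ereal (norm (\<mu>h h - orth_proj (Mh h) \<mu>) / norm (orth_proj (Mh h) \<mu>))
      \<le> 4 / alpha (Mh h) (Vh h) (Th h) *
        (ereal r * eps_op nE (Mh h) (Vh h) (Th h) T
         + rho T * (eps_rhs (Vh h) (fh h) f + ereal (eps_int (Mh h) \<mu>)))"
    if h: "h > 0" and asm: "eps_int (Mh h) \<mu> \<le> 1 / 2 \<and> alpha (Mh h) (Vh h) (Th h) > 0" for h
  proof -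
    let ?p = "orth_proj (Mh h) \<mu>"
    let ?e = "eps_op nE (Mh h) (Vh h) (Th h) T" and ?s = "eps_rhs (Vh h) (fh h) f"
    have p: "?p \<in> Mh h - {0}"
      using orth_proj_in[OF Mh_fin[OF h]] orth_proj_nonzero asm \<mu> by auto
    obtain v where v: "v \<in> Vh h - {0}"
      using alpha_pos_imp_nontrivial[OF conjunct2[OF asm] p] .
    obtain a where a: "alpha (Mh h) (Vh h) (Th h) = ereal a" "a > 0"
      using asm alpha_less_top[OF Th_op[OF h] p] by (cases "alpha (Mh h) (Vh h) (Th h)") auto
    have "linear_form_on (Vh h) (Th h ?p)"
      using Th_op[OF h] p by (simp add: bounded_operator_on_def)
    then have e0: "?e \<ge> 0"
      by (rule eps_op_nonneg[where nE = nE, OF _ V[OF h] v p nE(1)[OF h conjunct1[OF asm]]])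
    have s0: "?s \<ge> 0"
      by (rule eps_rhs_nonneg[OF fh_form[OF h] V[OF h] v f_nz])
    have i0: "eps_int (Mh h) \<mu> \<ge> 0"
      by (simp add: eps_int_def)
    show ?thesis
    \<comment> \<open>An infinite error makes the right-hand side infinite, since \<open>r\<close>,
      \<open>R\<close> and \<open>4 / a\<close> are positive and the other terms nonnegative.
      Otherwise both errors are real.\<close>
    proof (cases "?e = \<infinity> \<or> ?s = \<infinity>")
      case True
      then have top: "ereal r * ?e + rho T * (?s + ereal (eps_int (Mh h) \<mu>)) = \<infinity>"
        using e0 s0 i0 R r_pos by (cases ?e; cases ?s) auto
      show ?thesis
        unfolding top using a by simp
    next
      case False
      then obtain e s where es: "?e = ereal e" "?s = ereal s"
        using e0 s0 by (cases ?e; cases ?s) auto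
      then show ?thesis
        using bound[OF h h h h h conjunct1[OF asm] nE[OF h conjunct1[OF asm]], of e s R a]
          e0 s0 a R r_pos by simp
    qed
  qed

  assume asm: "(\<exists>\<alpha>::real. \<alpha> > 0 \<and> (\<forall>h>0. alpha (Mh h) (Vh h) (Th h) \<ge> ereal \<alpha>)) \<and>
    ((\<lambda>h. eps_op nE (Mh h) (Vh h) (Th h) T) \<longlongrightarrow> 0) (at_right 0) \<and>
    ((\<lambda>h. eps_rhs (Vh h) (fh h) f) \<longlongrightarrow> 0) (at_right 0)"
  then obtain a where a: "a > 0" "\<And>h. h > 0 \<Longrightarrow> ereal a \<le> alpha (Mh h) (Vh h) (Th h)"
    by blast
  have int: "((\<lambda>h. eps_int (Mh h) \<mu>) \<longlongrightarrow> 0) (at_right 0)"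
    by (rule eps_int_tendsto_0[OF Mh_fin Mh_approaches])
  \<comment> \<open>With all three errors below \<delta>, the distance to the projection is at most
    \<open>4 / a * (r + 2 * R) * \<delta>\<close> times \<open>2 * norm \<mu>\<close>, and the
    interpolation error adds \<open>\<delta> * norm \<mu>\<close>; the total is
    \<open>C * \<delta>\<close>.\<close>
  define C where "C = 8 / a * (r + 2 * R) * norm \<mu> + norm \<mu>"
  have C: "C > 0"
    unfolding C_def using a R r_pos \<mu> by (intro add_nonneg_pos) auto
  show "((\<lambda>h. norm (\<mu>h h - \<mu>)) \<longlongrightarrow> 0) (at_right 0)"
  proof (rule order_tendstoI)
    fix y :: real assume "0 < y"
    \<comment> \<open>The bound 1/2 secures the hypothesis on \<open>eps_int\<close>; the other one
      gives \<open>C * \<delta> \<le> y / 2\<close>, strictly below \<open>y\<close>.\<close>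
    define \<delta> where "\<delta> = min (1 / 2) (y / (2 * C))"
    have \<delta>: "0 < \<delta>" "\<delta> \<le> 1 / 2" "C * \<delta> < y"
      using C \<open>0 < y\<close> by (auto simp: \<delta>_def min_def field_simps)
    have "\<forall>\<^sub>F h in at_right 0. eps_op nE (Mh h) (Vh h) (Th h) T < ereal \<delta>"
      "\<forall>\<^sub>F h in at_right 0. eps_rhs (Vh h) (fh h) f < ereal \<delta>"
      "\<forall>\<^sub>F h in at_right 0. eps_int (Mh h) \<mu> < \<delta>"
      using asm int \<delta>(1) by (auto intro: order_tendstoD(2))
    then show "\<forall>\<^sub>F h in at_right 0. norm (\<mu>h h - \<mu>) < y"
      using eventually_at_right_less[of "0::real"]
    proof eventually_elim
      case (elim h)
      let ?p = "orth_proj (Mh h) \<mu>"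
      have i: "eps_int (Mh h) \<mu> \<le> 1 / 2"
        using elim \<delta> by linarith
      have h: "h > 0"
        using elim by simp
      have p: "?p \<noteq> 0"
        using orth_proj_nonzero i \<mu> by blast
      have pm: "norm (?p - \<mu>) \<le> \<delta> * norm \<mu>"
        using elim(3) \<mu> by (simp add: eps_int_def divide_simps)
      also have "\<dots> \<le> 1 * norm \<mu>"
        using \<delta> by (intro mult_right_mono) auto
      \<comment> \<open>This bound, uniform in \<open>h\<close>, turns the relative error into an
        absolute one.\<close>
      finally have p_le: "norm ?p \<le> 2 * norm \<mu>"
        using norm_triangle_ineq2[of ?p \<mu>] by simp
      have "norm (\<mu>h h - ?p) / norm ?p \<le> 4 / a * (r * \<delta> + R * (\<delta> + eps_int (Mh h) \<mu>))"
        using bound[OF h h h h h i nE[OF h i], of \<delta> \<delta> R a] elim \<delta> R a r_pos by simp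
      also have "\<dots> \<le> 4 / a * (r * \<delta> + R * (\<delta> + \<delta>))"
        using elim a R by (intro mult_left_mono add_left_mono) auto
      finally have "norm (\<mu>h h - ?p) \<le> 4 / a * (r * \<delta> + R * (\<delta> + \<delta>)) * norm ?p"
        using p by (simp only: pos_divide_le_eq zero_less_norm_iff simp_thms)
      also have "\<dots> \<le> 4 / a * (r * \<delta> + R * (\<delta> + \<delta>)) * (2 * norm \<mu>)"
        using p_le a R r_pos \<delta> by (intro mult_left_mono) auto
      finally have "norm (\<mu>h h - \<mu>) \<le> 4 / a * (r * \<delta> + R * (\<delta> + \<delta>)) * (2 * norm \<mu>) + \<delta> * norm \<mu>"
        using norm_triangle_ineq[of "\<mu>h h - ?p" "?p - \<mu>"] pm by simp
      also have "\<dots> = C * \<delta>"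
        by (simp add: C_def field_simps)
      finally show ?case
        using \<delta>(3) by linarith
    qed
  next
    fix y :: real assume "y < 0"
    then show "\<forall>\<^sub>F h in at_right 0. y < norm (\<mu>h h - \<mu>)"
      by (intro always_eventually allI) (rule less_le_trans[OF _ norm_ge_zero])
  qed
qed

end
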